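(* Let $G$ be a discrete group, $B=\bigoplus_{k\in G}B_k$ a $G$-graded unital algebra over $\mathbb{C}$ which is a $\mathbb{C}G$ Hopf-Galois extension of its identity-degree part $A$. Let $B$ have a $G$-graded differential calculus $(\Omega^*B,\mathrm{d},\wedge)$ containing a differential calculus $(\Omega^*A,\mathrm{d},\wedge)$ of $A$ as a sub-differential graded algebra, such that $B_k.\Omega^1A.B_{k^{-1}}\subset\Omega^1A$ for all $k\in G$. Fix $g\in G$, let $L=B_g$ (as $A$-bimodule), and choose $c\otimes c'\in B_{g^{-1}}\otimes_{\mathbb{C}}B_g$ (summation implicit) with $c\,c'=1_B$. Let $h\otimes h'$ and $f\otimes f'$ be independent copies of $c\otimes c'$. For a left covariant derivative $\nabla_L$ on $L$ write $\nabla_L(e)=\mathrm{d}(e\,c)\otimes c'+\tilde\Gamma(e)$. The general form of $\tilde\Gamma$ is $$\tilde\Gamma(e)=e.\zeta.c\otimes c'\qquad\text{for some }\zeta\in\Omega^1A,$$ and this gives the general form of the covariant derivative and its curvature as $$\nabla_L(e)=\mathrm{d}(e\,c)\otimes c'+e.\zeta.c\otimes c',$$ $$\mathrm{R}_L(e)=e\,h.\mathrm{d}(h'.\zeta.c)\otimes c'-e\,f.\mathrm{d}(f'c)\wedge\mathrm{d}(c'h)\otimes h'-e.\zeta.c\wedge c'.\zeta.h\otimes h'$$ $$\phantom{\mathrm{R}_L(e)}=e\,h.\mathrm{d}(h'.\zeta.c)\otimes c'-\mathrm{d}(e\,c)\wedge\mathrm{d}(c'h)\otimes h'-e.\zeta.c\wedge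 c'.\zeta.h\otimes h'$$ for all $e\in L$.
   Context: The $G$-grading of $B$ corresponds to the coaction $\rho:B\to B\otimes\mathbb{C}G$, $\rho(b)=b\otimes\underline k$ for $b\in B_k$ ($\underline k$ the basis element of $\mathbb{C}G$). $B$ is a $\mathbb{C}G$ Hopf-Galois extension of $A$ if the canonical map $B\otimes_A B\to B\otimes\mathbb{C}G$, $b'\otimes b\mapsto b'b\otimes\underline k$ for $b\in B_k$, is bijective. A differential calculus $(\Omega^*A,\mathrm{d},\wedge)$ on $A$ is a differential graded algebra with $\Omega^0A=A$. A left covariant derivative on a left $A$-module $E$ is a ($\mathbb{C}$-linear) map $\nabla:E\to\Omega^1A\otimes_A E$ with $\nabla(a.e)=\mathrm{d}a\otimes e+a.\nabla e$. Its curvature is $\mathrm{R}=(\mathrm{d}\otimes\mathrm{id}-\mathrm{id}\wedge\nabla)\nabla:E\to\Omega^2A\otimes_A E$, i.e. if $\nabla e=\sum\xi\otimes l$ then $\mathrm{R}(e)=\sum(\mathrm{d}\xi\otimes l-\xi\wedge\nabla l)$. "General form" means that the left covariant derivatives on $L$ are exactly the maps of the displayed form for $\zeta\in\Omega^1A$. The expressions are understood in $\Omega^1A\otimes_A L$ and $\Omega^2A\otimes_A L$. *)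

theory Defs
  imports Complex_Main "HOL-Algebra.Free_Abelian_Groups" "HOL-Algebra.Generated_Groups"
begin

section \<open>Balanced tensor products\<close>

text \<open>
  For a right \<open>R\<close>-module \<open>M\<close> and a left \<open>R\<close>-module \<open>N\<close> the group \<open>M \<otimes>\<^sub>R N\<close> is the free abelian
  group on \<open>M \<times> N\<close> modulo the subgroup generated by the relations below. Formal sums are of type
  \<open>('m \<times> 'n) formal_sum\<close>, with integer coefficients; elements of the tensor product are cosets of
  formal sums. The group is written multiplicatively, as always in HOL-Algebra, so that
  \<open>X \<otimes>\<^bsub>T\<^esub> Y\<close> is the \<^emph>\<open>sum\<close> of the elements \<open>X\<close> and \<open>Y\<close> of the tensor product \<open>T\<close>.
\<close>

type_synonym 'a formal_sum = "'a \<Rightarrow>\<^sub>0 int"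

definition balanced_relations ::
  "('m \<Rightarrow> 'r \<Rightarrow> 'm) \<Rightarrow> ('r \<Rightarrow> 'n \<Rightarrow> 'n) \<Rightarrow> 'r set \<Rightarrow> 'm::ab_group_add set \<Rightarrow> 'n::ab_group_add set
    \<Rightarrow> ('m \<times> 'n) formal_sum set"
  where "balanced_relations ract lact R M N =
    {frag_of (m + m', n) - frag_of (m, n) - frag_of (m', n) | m m' n. m \<in> M \<and> m' \<in> M \<and> n \<in> N} \<union>
    {frag_of (m, n + n') - frag_of (m, n) - frag_of (m, n') | m n n'. m \<in> M \<and> n \<in> N \<and> n' \<in> N} \<union>
    {frag_of (ract m r, n) - frag_of (m, lact r n) | m r n. m \<in> M \<and> r \<in> R \<and> n \<in> N}"

definition balanced_tensor ::
  "('m \<Rightarrow> 'r \<Rightarrow> 'm) \<Rightarrow> ('r \<Rightarrow> 'n \<Rightarrow> 'n) \<Rightarrow> 'r set \<Rightarrow> 'm::ab_group_add set \<Rightarrow> 'n::ab_group_add set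
    \<Rightarrow> ('m \<times> 'n) formal_sum set monoid"
  where "balanced_tensor ract lact R M N =
    free_Abelian_group (M \<times> N) Mod
      generate (free_Abelian_group (M \<times> N)) (balanced_relations ract lact R M N)"

text \<open>
  The class of a formal sum in a tensor product \<open>T\<close>; \<open>\<one>\<^bsub>T\<^esub>\<close> is the zero coset, i.e. the
  subgroup of relations itself. The pure tensor \<open>m \<otimes> n\<close> is \<open>tensor_class T (frag_of (m, n))\<close>.
\<close>

definition tensor_class :: "'a formal_sum set monoid \<Rightarrow> 'a formal_sum \<Rightarrow> 'a formal_sum set"
  where "tensor_class T u = (\<lambda>v. v + u) ` \<one>\<^bsub>T\<^esub>"

text \<open>
  The additive map out of a tensor product with \<open>m \<otimes> n \<mapsto> f (m, n)\<close>: extend \<open>f\<close> to formal sums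
  and take the common value on all representatives of the coset. It is meaningful when \<open>f\<close> is
  biadditive and balanced; otherwise \<open>the_elem\<close> yields an unspecified value.
\<close>

definition tensor_lift :: "'b monoid \<Rightarrow> ('a \<Rightarrow> 'b) \<Rightarrow> 'a formal_sum set \<Rightarrow> 'b"
  where "tensor_lift H f X = the_elem
    ((\<lambda>u. finprod H (\<lambda>p. f p [^]\<^bsub>H\<^esub> Poly_Mapping.lookup u p) (Poly_Mapping.keys u)) ` X)"


section \<open>Graded algebras and differential calculi\<close>

text \<open>
  \<open>V\<close> is \<open>\<Oplus>\<^sub>i U i\<close>: summation is a bijection onto \<open>V\<close> from the finitely supported families
  with \<open>i\<close>-th entry in \<open>U i\<close>.
\<close>

definition families :: "('i \<Rightarrow> 'w::comm_monoid_add set) \<Rightarrow> ('i \<Rightarrow>\<^sub>0 'w) set"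
  where "families U = {x. \<forall>i. Poly_Mapping.lookup x i \<in> U i}"

definition family_sum :: "('i \<Rightarrow>\<^sub>0 'w::comm_monoid_add) \<Rightarrow> 'w"
  where "family_sum x = (\<Sum>i\<in>Poly_Mapping.keys x. Poly_Mapping.lookup x i)"

definition is_direct_sum :: "'w::comm_monoid_add set \<Rightarrow> ('i \<Rightarrow> 'w set) \<Rightarrow> bool"
  where "is_direct_sum V U \<longleftrightarrow> bij_betw family_sum (families U) V"

definition components :: "('i \<Rightarrow> 'w::comm_monoid_add set) \<Rightarrow> 'w \<Rightarrow> ('i \<Rightarrow>\<^sub>0 'w)"
  where "components U = inv_into (families U) family_sum"

text \<open>
  The unit is a parameter and the carrier type is only of class \<open>ring\<close>, because \<open>ring_1\<close> would
  exclude the zero algebra.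
\<close>

locale unital_complex_algebra = vector_space scale
  for scale :: "complex \<Rightarrow> 'w::ring \<Rightarrow> 'w" +
  fixes unt :: 'w
  assumes scale_mult_left: "scale r x * y = scale r (x * y)"
    and scale_mult_right: "x * scale r y = scale r (x * y)"
    and unit_left: "unt * x = x"
    and unit_right: "x * unt = x"

text \<open>A group, not necessarily abelian, is a type of class \<open>group_add\<close>.\<close>

locale graded_algebra = unital_complex_algebra scale unt
  for scale :: "complex \<Rightarrow> 'w::ring \<Rightarrow> 'w" and unt :: 'w +
  fixes B :: "'w set" and Bk :: "'g::group_add \<Rightarrow> 'w set"
  assumes subspace_component: "subspace (Bk k)"
    and direct_sum: "is_direct_sum B Bk"
    and unit_mem: "unt \<in> Bk 0"
    and mult_mem: "\<lbrakk>x \<in> Bk k; y \<in> Bk l\<rbrakk> \<Longrightarrow> x * y \<in> Bk (k + l)"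

text \<open>
  A differential calculus on \<open>B\<close>: the type \<open>'w\<close> is the whole differential graded algebra
  \<open>\<Oplus>\<^sub>n \<Omega> n\<close>, with product \<open>\<and>\<close>, and \<open>B = \<Omega> 0\<close> is a subset of it.
\<close>

locale differential_calculus = unital_complex_algebra scale unt
  for scale :: "complex \<Rightarrow> 'w::ring \<Rightarrow> 'w" and unt :: 'w +
  fixes B :: "'w set" and \<Omega> :: "nat \<Rightarrow> 'w set" and d :: "'w \<Rightarrow> 'w"
  assumes subspace_forms: "subspace (\<Omega> n)"
    and direct_sum_forms: "is_direct_sum UNIV \<Omega>"
    and forms_0: "\<Omega> 0 = B"
    and unit_mem: "unt \<in> \<Omega> 0"
    and wedge_mem: "\<lbrakk>\<xi> \<in> \<Omega> m; \<eta> \<in> \<Omega> n\<rbrakk> \<Longrightarrow> \<xi> * \<eta> \<in> \<Omega> (m + n)"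
    and d_add: "d (\<xi> + \<eta>) = d \<xi> + d \<eta>"
    and d_scale: "d (scale r \<xi>) = scale r (d \<xi>)"
    and d_mem: "\<xi> \<in> \<Omega> n \<Longrightarrow> d \<xi> \<in> \<Omega> (Suc n)"
    and d_d: "d (d \<xi>) = 0"
    and d_wedge: "\<xi> \<in> \<Omega> n \<Longrightarrow> d (\<xi> * \<eta>) = d \<xi> * \<eta> + scale ((-1) ^ n) (\<xi> * d \<eta>)"

locale graded_differential_calculus = differential_calculus scale unt B \<Omega> d
  for scale :: "complex \<Rightarrow> 'w::ring \<Rightarrow> 'w" and unt :: 'w
    and B :: "'w set" and \<Omega> :: "nat \<Rightarrow> 'w set" and d :: "'w \<Rightarrow> 'w" +
  fixes Bk :: "'g::group_add \<Rightarrow> 'w set" and \<Omega>k :: "nat \<Rightarrow> 'g \<Rightarrow> 'w set"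
  assumes subspace_graded: "subspace (\<Omega>k n k)"
    and direct_sum_graded: "is_direct_sum (\<Omega> n) (\<Omega>k n)"
    and graded_0: "\<Omega>k 0 = Bk"
    and wedge_graded: "\<lbrakk>\<xi> \<in> \<Omega>k m k; \<eta> \<in> \<Omega>k n l\<rbrakk> \<Longrightarrow> \<xi> * \<eta> \<in> \<Omega>k (m + n) (k + l)"
    and d_graded: "\<xi> \<in> \<Omega>k n k \<Longrightarrow> d \<xi> \<in> \<Omega>k (Suc n) k"

text \<open>
  A differential calculus \<open>\<Omega>A\<close> on the subalgebra \<open>A\<close> which is a sub-differential graded algebra of
  the given calculus. The algebra and derivation laws are inherited.
\<close>

locale sub_calculus = differential_calculus scale unt B \<Omega> d
  for scale :: "complex \<Rightarrow> 'w::ring \<Rightarrow> 'w" and unt :: 'w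
    and B :: "'w set" and \<Omega> :: "nat \<Rightarrow> 'w set" and d :: "'w \<Rightarrow> 'w" +
  fixes A :: "'w set" and \<Omega>A :: "nat \<Rightarrow> 'w set"
  assumes sub_forms: "\<Omega>A n \<subseteq> \<Omega> n"
    and sub_subspace: "subspace (\<Omega>A n)"
    and sub_forms_0: "\<Omega>A 0 = A"
    and sub_unit: "unt \<in> \<Omega>A 0"
    and sub_wedge: "\<lbrakk>\<xi> \<in> \<Omega>A m; \<eta> \<in> \<Omega>A n\<rbrakk> \<Longrightarrow> \<xi> * \<eta> \<in> \<Omega>A (m + n)"
    and sub_d: "\<xi> \<in> \<Omega>A n \<Longrightarrow> d \<xi> \<in> \<Omega>A (Suc n)"


section \<open>Hopf-Galois extensions\<close>

text \<open>
  The group algebra of \<open>'g\<close> is \<open>'g \<Rightarrow>\<^sub>0 complex\<close>, with basis \<open>Poly_Mapping.single k 1\<close>. A formal sum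
  representing \<open>b' \<rho>(b)\<close>, where \<open>\<rho>\<close> is the coaction, is \<open>\<Sum>\<^sub>k b' b\<^sub>k \<otimes> k\<close>.
\<close>

definition tensor_group_algebra ::
  "(complex \<Rightarrow> 'w::ring \<Rightarrow> 'w) \<Rightarrow> 'w set \<Rightarrow> ('w \<times> ('g \<Rightarrow>\<^sub>0 complex)) formal_sum set monoid"
  where "tensor_group_algebra scale B =
    balanced_tensor (\<lambda>b r. scale r b) (\<lambda>r. Poly_Mapping.map ((*) r)) UNIV B UNIV"

definition canonical_map ::
  "(complex \<Rightarrow> 'w::ring \<Rightarrow> 'w) \<Rightarrow> 'w set \<Rightarrow> ('g \<Rightarrow> 'w set) \<Rightarrow> ('w \<times> 'w) formal_sum set
    \<Rightarrow> ('w \<times> ('g \<Rightarrow>\<^sub>0 complex)) formal_sum set"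
  where "canonical_map scale B Bk =
    tensor_lift (tensor_group_algebra scale B)
      (\<lambda>(b', b). tensor_class (tensor_group_algebra scale B)
        (\<Sum>k\<in>Poly_Mapping.keys (components Bk b).
          frag_of (b' * Poly_Mapping.lookup (components Bk b) k, Poly_Mapping.single k 1)))"

definition hopf_galois ::
  "(complex \<Rightarrow> 'w::ring \<Rightarrow> 'w) \<Rightarrow> 'w set \<Rightarrow> ('g::group_add \<Rightarrow> 'w set) \<Rightarrow> bool"
  where "hopf_galois scale B Bk \<longleftrightarrow>
    bij_betw (canonical_map scale B Bk)
      (carrier (balanced_tensor (*) (*) (Bk 0) B B))
      (carrier (tensor_group_algebra scale B))"


section \<open>Left covariant derivatives\<close>

definition forms_tensor :: "(nat \<Rightarrow> 'w::ring set) \<Rightarrow> nat \<Rightarrow> 'w set \<Rightarrow> ('w \<times> 'w) formal_sum set monoid"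
  where "forms_tensor \<Omega>A n E = balanced_tensor (*) (*) (\<Omega>A 0) (\<Omega>A n) E"

text \<open>The map \<open>\<xi> \<otimes> l \<mapsto> f \<xi> \<otimes> l\<close> into \<open>T\<close>.\<close>

definition tensor_map_left ::
  "('m \<times> 'n) formal_sum set monoid \<Rightarrow> ('m \<Rightarrow> 'm) \<Rightarrow> ('m \<times> 'n) formal_sum set \<Rightarrow> ('m \<times> 'n) formal_sum set"
  where "tensor_map_left T f = tensor_lift T (\<lambda>(\<xi>, l). tensor_class T (frag_of (f \<xi>, l)))"

text \<open>
  The left \<open>A\<close>-module \<open>E\<close>, where \<open>A = \<Omega>A 0\<close>, is a subspace of the ambient algebra on which \<open>A\<close> acts
  by multiplication.
\<close>

definition left_covariant_derivative ::
  "(complex \<Rightarrow> 'w::ring \<Rightarrow> 'w) \<Rightarrow> ('w \<Rightarrow> 'w) \<Rightarrow> (nat \<Rightarrow> 'w set) \<Rightarrow> 'w set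
    \<Rightarrow> ('w \<Rightarrow> ('w \<times> 'w) formal_sum set) \<Rightarrow> bool"
  where "left_covariant_derivative scale d \<Omega>A E D \<longleftrightarrow>
    (let T = forms_tensor \<Omega>A 1 E in
      D \<in> E \<rightarrow> carrier T \<and>
      (\<forall>e\<in>E. \<forall>e'\<in>E. D (e + e') = D e \<otimes>\<^bsub>T\<^esub> D e') \<and>
      (\<forall>r. \<forall>e\<in>E. D (scale r e) = tensor_map_left T (scale r) (D e)) \<and>
      (\<forall>a\<in>\<Omega>A 0. \<forall>e\<in>E. D (a * e) =
        tensor_class T (frag_of (d a, e)) \<otimes>\<^bsub>T\<^esub> tensor_map_left T ((*) a) (D e)))"

text \<open>\<open>\<xi> \<otimes> l\<close> contributes \<open>d \<xi> \<otimes> l - \<xi> \<and> D l\<close> to the curvature.\<close>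

definition curvature ::
  "('w::ring \<Rightarrow> 'w) \<Rightarrow> (nat \<Rightarrow> 'w set) \<Rightarrow> 'w set \<Rightarrow> ('w \<Rightarrow> ('w \<times> 'w) formal_sum set)
    \<Rightarrow> 'w \<Rightarrow> ('w \<times> 'w) formal_sum set"
  where "curvature d \<Omega>A E D e =
    (let T = forms_tensor \<Omega>A 2 E in
      tensor_lift T
        (\<lambda>(\<xi>, l). tensor_class T (frag_of (d \<xi>, l)) \<otimes>\<^bsub>T\<^esub>
                  inv\<^bsub>T\<^esub> tensor_map_left T ((*) \<xi>) (D l))
        (D e))"

end

theory Submission
  imports Defs
begin

text \<open>
  Multiplication \<open>\<xi> \<otimes> l \<mapsto> \<xi> l\<close> embeds \<open>\<Omega>\<^sup>n A \<otimes>\<^sub>A L\<close> into the ambient algebra: since \<open>L c \<subseteq> A\<close> and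
  \<open>c c' = 1\<close>, the map \<open>w \<mapsto> w c \<otimes> c'\<close> is a left inverse. All identities between tensors can therefore be
  checked after multiplying out. There \<open>e \<mapsto> d(e c) c'\<close> is a covariant derivative, so any other one differs from it by
  a left \<open>A\<close>-linear map \<open>\<gamma>\<close>, and \<open>\<gamma>(e) = \<gamma>(e c c') = e \<zeta>\<close> with \<open>\<zeta> = c \<gamma>(c')\<close>. The curvature formulas
  follow from the Leibniz rule and \<open>c d(c' h) h' = 0\<close>.
\<close>

section \<open>Homomorphisms out of balanced tensor products\<close>

text \<open>The expression inside \<open>tensor_lift\<close> for a single representative of a coset.
  Isolating it gives its homomorphism property before anything is known about cosets.\<close>

definition formal_prod :: "('b, 'm) monoid_scheme \<Rightarrow> ('a \<Rightarrow> 'b) \<Rightarrow> 'a formal_sum \<Rightarrow> 'b"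
  where "formal_prod H f u = finprod H (\<lambda>p. f p [^]\<^bsub>H\<^esub> Poly_Mapping.lookup u p) (Poly_Mapping.keys u)"

lemma (in comm_group) formal_prod_superset:
  assumes "finite K" "Poly_Mapping.keys u \<subseteq> K" "f \<in> K \<rightarrow> carrier G"
  shows "formal_prod G f u = finprod G (\<lambda>p. f p [^] Poly_Mapping.lookup u p) K"
  unfolding formal_prod_def using assms
  by (intro finprod_mono_neutral_cong_left) (auto simp: in_keys_iff Pi_iff)

lemma (in comm_group) formal_prod_hom:
  assumes f: "f \<in> S \<rightarrow> carrier G"
  shows "formal_prod G f \<in> hom (free_Abelian_group S) G"
proof (rule homI)
  fix u v
  assume "u \<in> carrier (free_Abelian_group S)" "v \<in> carrier (free_Abelian_group S)"
  then have uv: "Poly_Mapping.keys u \<subseteq> S" "Poly_Mapping.keys v \<subseteq> S"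
    by simp_all
  \<comment> \<open>Cancellation can make the keys of \<open>u + v\<close> fewer than those of
    \<open>u\<close> and \<open>v\<close> together, so all three products are taken over the
    union.\<close>
  let ?K = "Poly_Mapping.keys u \<union> Poly_Mapping.keys v"
  have K: "finite ?K" "f \<in> ?K \<rightarrow> carrier G" "Poly_Mapping.keys (u + v) \<subseteq> ?K"
    using uv f keys_add[of u v] by auto
  have "formal_prod G f (u + v) = finprod G (\<lambda>p. f p [^] Poly_Mapping.lookup (u + v) p) ?K"
    using K by (rule_tac formal_prod_superset)
  also have "\<dots> = finprod G (\<lambda>p. f p [^] Poly_Mapping.lookup u p \<otimes> f p [^] Poly_Mapping.lookup v p) ?K"
    using K(2) by (intro finprod_cong') (auto simp: lookup_add int_pow_mult Pi_iff)
  also have "\<dots> = formal_prod G f u \<otimes> formal_prod G f v"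
    using K by (subst finprod_multf) (auto simp: formal_prod_superset[where K = ?K] Pi_iff)
  finally show "formal_prod G f (u \<otimes>\<^bsub>free_Abelian_group S\<^esub> v) = formal_prod G f u \<otimes> formal_prod G f v"
    by simp
next
  fix u assume "u \<in> carrier (free_Abelian_group S)"
  then show "formal_prod G f u \<in> carrier G"
    unfolding formal_prod_def using f by (intro finprod_closed) auto
qed

lemma (in comm_group) formal_prod_frag_of:
  "f p \<in> carrier G \<Longrightarrow> formal_prod G f (frag_of p) = f p"
  by (simp add: formal_prod_def)

lemma (in comm_group) formal_prod_diff:
  assumes "f \<in> S \<rightarrow> carrier G" "Poly_Mapping.keys u \<subseteq> S" "Poly_Mapping.keys v \<subseteq> S"
  shows "formal_prod G f (u - v) = formal_prod G f u \<otimes> inv formal_prod G f v"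
proof -
  interpret group_hom "free_Abelian_group S" G "formal_prod G f"
    using formal_prod_hom[OF assms(1)] by (simp add: group_hom_def group_hom_axioms_def)
  show ?thesis
    using hom_mult[of u "- v"] hom_inv[of v] assms by simp
qed

section \<open>Formal sums evaluated in the additive group of a type\<close>

definition additive_group :: "'a::ab_group_add monoid"
  where "additive_group = \<lparr>carrier = UNIV, monoid.mult = (+), one = 0\<rparr>"

lemma additive_group_simps [simp]:
  "carrier additive_group = UNIV" "x \<otimes>\<^bsub>additive_group\<^esub> y = x + y" "\<one>\<^bsub>additive_group\<^esub> = 0"
  by (simp_all add: additive_group_def)

lemma comm_group_additive_group [simp]: "comm_group (additive_group :: 'a::ab_group_add monoid)"
proof (rule comm_groupI)
  fix x :: 'a
  show "\<exists>y\<in>carrier additive_group. y \<otimes>\<^bsub>additive_group\<^esub> x = \<one>\<^bsub>additive_group\<^esub>"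
    by (rule bexI[of _ "- x"]) auto
qed (auto simp: algebra_simps)

lemma group_additive_group [simp]: "group (additive_group :: 'a::ab_group_add monoid)"
  using comm_group_additive_group comm_group.axioms(2) by blast

lemma inv_additive_group [simp]: "inv\<^bsub>additive_group\<^esub> x = - x"
  by (rule group.inv_equality) auto

definition formal_eval :: "('a \<Rightarrow> 'b::ab_group_add) \<Rightarrow> 'a formal_sum \<Rightarrow> 'b"
  where "formal_eval = formal_prod additive_group"

lemma formal_eval_frag_of [simp]: "formal_eval q (frag_of p) = q p"
  by (simp add: formal_eval_def comm_group.formal_prod_frag_of)

lemma formal_eval_diff [simp]: "formal_eval q (u - v) = formal_eval q u - formal_eval q v"
  by (simp add: formal_eval_def comm_group.formal_prod_diff[where S = UNIV])

lemma formal_eval_0 [simp]: "formal_eval q 0 = 0"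
  using formal_eval_diff[of q 0 0] by simp

lemma formal_eval_add [simp]: "formal_eval q (u + v) = formal_eval q u + formal_eval q v"
  using formal_eval_diff[of q "u + v" v] by simp

lemma formal_eval_sum [simp]: "formal_eval q (sum u I) = (\<Sum>i\<in>I. formal_eval q (u i))"
  by (induction I rule: infinite_finite_induct) simp_all

text \<open>Generators determine a homomorphism on formal sums. Compatibility is asked for
  differences because induction over a free abelian group proceeds through zero, generators and
  differences.\<close>

lemma formal_eval_unique:
  assumes "Poly_Mapping.keys u \<subseteq> S" "h 0 = 0"
    and "\<And>v w. \<lbrakk>Poly_Mapping.keys v \<subseteq> S; Poly_Mapping.keys w \<subseteq> S\<rbrakk> \<Longrightarrow> h (v - w) = h v - h w"
    and "\<And>p. p \<in> S \<Longrightarrow> h (frag_of p) = q p"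
  shows "h u = formal_eval q u"
  using assms(1) by (rule free_Abelian_group_induct) (simp_all add: assms)

section \<open>Relations, cosets and lifts for a balanced tensor product\<close>

locale balanced_pair =
  fixes ract :: "'m::ab_group_add \<Rightarrow> 'r \<Rightarrow> 'm" and lact :: "'r \<Rightarrow> 'n::ab_group_add \<Rightarrow> 'n"
    and R :: "'r set" and M :: "'m set" and N :: "'n set"
  assumes add_left_mem: "\<lbrakk>m \<in> M; m' \<in> M\<rbrakk> \<Longrightarrow> m + m' \<in> M"
    and add_right_mem: "\<lbrakk>n \<in> N; n' \<in> N\<rbrakk> \<Longrightarrow> n + n' \<in> N"
    and ract_mem: "\<lbrakk>m \<in> M; r \<in> R\<rbrakk> \<Longrightarrow> ract m r \<in> M"
    and lact_mem: "\<lbrakk>r \<in> R; n \<in> N\<rbrakk> \<Longrightarrow> lact r n \<in> N"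
begin

abbreviation free where "free \<equiv> free_Abelian_group (M \<times> N)"
abbreviation relations where "relations \<equiv> balanced_relations ract lact R M N"
abbreviation tensor where "tensor \<equiv> balanced_tensor ract lact R M N"
abbreviation rel where "rel \<equiv> generate free relations"

text \<open>Closure of \<open>M\<close> and \<open>N\<close> under addition and the actions makes
  each relator a formal sum on \<open>M \<times> N\<close>.\<close>

lemma relations_subset: "relations \<subseteq> carrier free"
  unfolding balanced_relations_def
  by (auto dest!: subsetD[OF keys_diff] simp: add_left_mem add_right_mem ract_mem lact_mem)

lemma subgroup_rel: "subgroup rel free"
  by (rule group.generate_is_subgroup) (simp_all only: group_free_Abelian_group relations_subset)

lemma normal_rel: "rel \<lhd> free"
  by (simp add: abelian_free_Abelian_group comm_group.normal_iff_subgroup subgroup_rel)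

lemma rel_zero: "0 \<in> rel"
  using subgroup.one_closed[OF subgroup_rel] by simp

lemma rel_add: "\<lbrakk>u \<in> rel; v \<in> rel\<rbrakk> \<Longrightarrow> u + v \<in> rel"
  using subgroup.m_closed[OF subgroup_rel] by simp

lemma rel_minus: "u \<in> rel \<Longrightarrow> - u \<in> rel"
  using subgroup.m_inv_closed[OF subgroup_rel] subgroup.mem_carrier[OF subgroup_rel] by fastforce

lemma rel_diff: "\<lbrakk>u \<in> rel; v \<in> rel\<rbrakk> \<Longrightarrow> u - v \<in> rel"
  using rel_add[OF _ rel_minus] by force

lemma rel_sum: "(\<And>i. i \<in> I \<Longrightarrow> u i \<in> rel) \<Longrightarrow> sum u I \<in> rel"
  by (induction I rule: infinite_finite_induct) (auto simp: rel_zero rel_add)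

lemma add_left_rel: "\<lbrakk>m \<in> M; m' \<in> M; n \<in> N\<rbrakk> \<Longrightarrow> frag_of (m + m', n) - frag_of (m, n) - frag_of (m', n) \<in> rel"
  by (rule generate.incl) (unfold balanced_relations_def, blast)

lemma add_right_rel: "\<lbrakk>m \<in> M; n \<in> N; n' \<in> N\<rbrakk> \<Longrightarrow> frag_of (m, n + n') - frag_of (m, n) - frag_of (m, n') \<in> rel"
  by (rule generate.incl) (unfold balanced_relations_def, blast)

lemma balanced_rel: "\<lbrakk>m \<in> M; r \<in> R; n \<in> N\<rbrakk> \<Longrightarrow> frag_of (ract m r, n) - frag_of (m, lact r n) \<in> rel"
  by (rule generate.incl) (unfold balanced_relations_def, blast)

lemma comm_group_tensor: "comm_group tensor"
  unfolding balanced_tensor_def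
  by (rule comm_group.abelian_FactGroup[OF abelian_free_Abelian_group subgroup_rel])

lemma one_tensor: "\<one>\<^bsub>tensor\<^esub> = rel"
  by (simp add: balanced_tensor_def)

lemma tensor_class_eq_coset: "tensor_class tensor u = r_coset free rel u"
  unfolding tensor_class_def one_tensor r_coset_def by auto

lemma carrier_tensor: "carrier tensor = tensor_class tensor ` {u. Poly_Mapping.keys u \<subseteq> M \<times> N}"
proof -
  have "carrier free = {u. Poly_Mapping.keys u \<subseteq> M \<times> N}"
    by (simp add: free_Abelian_group_def)
  moreover have "tensor_class tensor = r_coset free rel"
    by (simp add: fun_eq_iff tensor_class_eq_coset)
  ultimately show ?thesis
    using carrier_FactGroup[of free rel] by (simp only: balanced_tensor_def[symmetric])
qed

lemma tensor_class_mem: "Poly_Mapping.keys u \<subseteq> M \<times> N \<Longrightarrow> tensor_class tensor u \<in> carrier tensor"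
  by (auto simp: carrier_tensor)

lemma tensor_class_hom: "tensor_class tensor \<in> hom free tensor"
proof (rule homI)
  fix u v assume "u \<in> carrier free" "v \<in> carrier free"
  then show "tensor_class tensor (u \<otimes>\<^bsub>free\<^esub> v) = tensor_class tensor u \<otimes>\<^bsub>tensor\<^esub> tensor_class tensor v"
    using normal.rcos_sum[OF normal_rel, of u v]
    by (simp only: tensor_class_eq_coset) (simp add: balanced_tensor_def)
qed (simp add: tensor_class_mem)

lemma tensor_class_eqI:
  assumes "u - v \<in> rel"
  shows "tensor_class tensor u = tensor_class tensor v"
proof -
  have "w + u \<in> (\<lambda>w. w + v) ` rel" if "w \<in> rel" for w
    using rel_add[OF that assms] by (intro image_eqI[of _ _ "w + (u - v)"]) auto
  moreover have "w + v \<in> (\<lambda>w. w + u) ` rel" if "w \<in> rel" for w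
    using rel_diff[OF that assms] by (intro image_eqI[of _ _ "w - (u - v)"]) auto
  ultimately show ?thesis
    by (auto simp: tensor_class_def one_tensor)
qed

text \<open>\<open>formal_prod H f\<close> is a homomorphism whose kernel contains the relators,
  hence also the subgroup they generate. It is therefore constant on each coset, and
  \<open>the_elem\<close> returns that constant.\<close>

lemma tensor_lift_class:
  assumes H: "comm_group H" and f: "f \<in> M \<times> N \<rightarrow> carrier H"
    and add_left: "\<And>m m' n. \<lbrakk>m \<in> M; m' \<in> M; n \<in> N\<rbrakk> \<Longrightarrow> f (m + m', n) = f (m, n) \<otimes>\<^bsub>H\<^esub> f (m', n)"
    and add_right: "\<And>m n n'. \<lbrakk>m \<in> M; n \<in> N; n' \<in> N\<rbrakk> \<Longrightarrow> f (m, n + n') = f (m, n) \<otimes>\<^bsub>H\<^esub> f (m, n')"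
    and balanced: "\<And>m r n. \<lbrakk>m \<in> M; r \<in> R; n \<in> N\<rbrakk> \<Longrightarrow> f (ract m r, n) = f (m, lact r n)"
    and u: "Poly_Mapping.keys u \<subseteq> M \<times> N"
  shows "tensor_lift H f (tensor_class tensor u) = formal_prod H f u"
proof -
  interpret H: comm_group H by fact
  interpret group_hom free H "formal_prod H f"
    using H.formal_prod_hom[OF f] by (simp add: group_hom_def group_hom_axioms_def)
  note mem = funcset_mem[OF f]
  have *: "Poly_Mapping.keys (frag_of p - frag_of q) \<subseteq> M \<times> N" if "p \<in> M \<times> N" "q \<in> M \<times> N" for p q
    using keys_diff[of "frag_of p" "frag_of q"] that by auto
  \<comment> \<open>The image of an additivity relator, once the value of \<open>f\<close> at a sum
    has been split.\<close>
  have cancel: "x \<otimes>\<^bsub>H\<^esub> y \<otimes>\<^bsub>H\<^esub> inv\<^bsub>H\<^esub> x \<otimes>\<^bsub>H\<^esub> inv\<^bsub>H\<^esub> y = \<one>\<^bsub>H\<^esub>"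
    if "x \<in> carrier H" "y \<in> carrier H" for x y
    using that H.r_inv[of "x \<otimes>\<^bsub>H\<^esub> y"] by (simp add: H.inv_mult H.m_assoc)
  have "formal_prod H f v = \<one>\<^bsub>H\<^esub>" if "v \<in> relations" for v
    using that unfolding balanced_relations_def
    by (auto simp: H.formal_prod_diff[OF f] H.formal_prod_frag_of add_left add_right balanced * mem
        add_left_mem add_right_mem ract_mem lact_mem cancel)
  then have "relations \<subseteq> kernel free H (formal_prod H f)"
    using relations_subset unfolding kernel_def by blast
  then have "rel \<subseteq> kernel free H (formal_prod H f)"
    using G.generate_subgroup_incl subgroup_kernel by blast
  then have "formal_prod H f (v + u) = formal_prod H f u" if "v \<in> rel" for v
    using that hom_mult[of v u] u by (auto simp: kernel_def)
  \<comment> \<open>The zero relation keeps the coset nonempty, so the image is a singleton and not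
    merely contained in one.\<close>
  then have "formal_prod H f ` tensor_class tensor u = {formal_prod H f u}"
    unfolding tensor_class_def one_tensor using rel_zero by force
  then show ?thesis
    by (simp add: tensor_lift_def formal_prod_def[abs_def])
qed

end

section \<open>Calculi with a module frame\<close>

lemma keys_sum_subset:
  fixes u :: "'a \<Rightarrow> 'b formal_sum"
  shows "(\<And>i. i \<in> I \<Longrightarrow> Poly_Mapping.keys (u i) \<subseteq> S) \<Longrightarrow> Poly_Mapping.keys (sum u I) \<subseteq> S"
  using sum_closed_free_Abelian_group[of I u S] by simp

lemma keys_add_subset: "\<lbrakk>Poly_Mapping.keys u \<subseteq> S; Poly_Mapping.keys v \<subseteq> S\<rbrakk> \<Longrightarrow> Poly_Mapping.keys (u + v) \<subseteq> S"
  using keys_add[of u v] by blast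

lemma keys_diff_subset: "\<lbrakk>Poly_Mapping.keys u \<subseteq> S; Poly_Mapping.keys v \<subseteq> S\<rbrakk> \<Longrightarrow> Poly_Mapping.keys (u - v) \<subseteq> S"
  using keys_diff[of u v] by blast

text \<open>An element of \<open>U i\<close> is the sum of the family concentrated at
  \<open>i\<close>; since \<open>0\<close> lies in every summand, this family is admissible.\<close>

lemma component_subset:
  assumes "is_direct_sum V U" "\<And>i. 0 \<in> U i"
  shows "U i \<subseteq> V"
proof
  fix x assume x: "x \<in> U i"
  have "Poly_Mapping.single i x \<in> families U"
    using x assms(2) by (simp add: families_def lookup_single when_def)
  moreover have "family_sum (Poly_Mapping.single i x) = x"
    by (simp add: family_sum_def)
  ultimately show "x \<in> V"
    using assms(1) unfolding is_direct_sum_def by (metis bij_betw_apply)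
qed

text \<open>What the grading provides in degrees \<open>g\<close> and \<open>- g\<close>, with
  \<open>L\<close> in the role of the component of degree \<open>g\<close>. The elements
  \<open>c\<close>, \<open>c'\<close> act as a dual basis: each \<open>l \<mapsto> l * c i\<close>
  is left \<open>A\<close>-linear from \<open>L\<close> to \<open>A\<close>, and \<open>l\<close> is
  the sum of the \<open>l * c i * c' i\<close>. The two sandwich conditions are the instances
  \<open>k = g\<close> and \<open>k = - g\<close> of the assumption on one-forms.\<close>

locale framed_calculus = sub_calculus scale unt B \<Omega> d A \<Omega>A
  for scale :: "complex \<Rightarrow> 'w::ring \<Rightarrow> 'w" and unt B \<Omega> d A \<Omega>A +
  fixes L :: "'w set" and N :: nat and c c' :: "nat \<Rightarrow> 'w"
  assumes subspace_L: "subspace L"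
    and c_mem: "i < N \<Longrightarrow> c i \<in> B"
    and c'_mem: "i < N \<Longrightarrow> c' i \<in> L"
    and frame_unit: "(\<Sum>i<N. c i * c' i) = unt"
    and L_act: "\<lbrakk>a \<in> A; l \<in> L\<rbrakk> \<Longrightarrow> a * l \<in> L"
    and L_mult_c: "\<lbrakk>l \<in> L; i < N\<rbrakk> \<Longrightarrow> l * c i \<in> A"
    and sandwich_L: "\<lbrakk>l \<in> L; \<xi> \<in> \<Omega>A 1; i < N\<rbrakk> \<Longrightarrow> l * \<xi> * c i \<in> \<Omega>A 1"
    and sandwich_c: "\<lbrakk>i < N; \<xi> \<in> \<Omega>A 1; l \<in> L\<rbrakk> \<Longrightarrow> c i * \<xi> * l \<in> \<Omega>A 1"
begin

lemma sum_frame: "(\<Sum>i<N. x * c i * c' i) = x"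
  using frame_unit by (simp add: mult.assoc unit_right flip: sum_distrib_left)

lemma A_act: "\<lbrakk>a \<in> \<Omega>A 0; \<xi> \<in> \<Omega>A n\<rbrakk> \<Longrightarrow> a * \<xi> \<in> \<Omega>A n"
  using sub_wedge[of a 0 \<xi> n] by simp

lemma act_A: "\<lbrakk>\<xi> \<in> \<Omega>A n; a \<in> \<Omega>A 0\<rbrakk> \<Longrightarrow> \<xi> * a \<in> \<Omega>A n"
  using sub_wedge[of \<xi> n a 0] by simp

lemma wedge_1_1: "\<lbrakk>\<xi> \<in> \<Omega>A 1; \<eta> \<in> \<Omega>A 1\<rbrakk> \<Longrightarrow> \<xi> * \<eta> \<in> \<Omega>A 2"
  using sub_wedge[of \<xi> 1 \<eta> 1] by (simp add: numeral_2_eq_2)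

lemma d_0_mem: "a \<in> \<Omega>A 0 \<Longrightarrow> d a \<in> \<Omega>A 1"
  using sub_d[of a 0] by simp

lemma d_1_mem: "\<xi> \<in> \<Omega>A 1 \<Longrightarrow> d \<xi> \<in> \<Omega>A 2"
  using sub_d[of \<xi> 1] by (simp add: numeral_2_eq_2)

lemma L_mult_c_0: "\<lbrakk>l \<in> L; i < N\<rbrakk> \<Longrightarrow> l * c i \<in> \<Omega>A 0"
  by (simp add: sub_forms_0 L_mult_c)

lemma d_zero: "d 0 = 0"
  using d_add[of 0 0] by simp

lemma d_sum: "d (sum f I) = (\<Sum>i\<in>I. d (f i))"
  by (induction I rule: infinite_finite_induct) (simp_all add: d_zero d_add)

lemma d_mult: "x \<in> \<Omega> 0 \<Longrightarrow> d (x * \<eta>) = d x * \<eta> + x * d \<eta>"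
  using d_wedge[of x 0 \<eta>] by simp

lemma d_mult_1: "\<xi> \<in> \<Omega>A 1 \<Longrightarrow> d (\<xi> * \<eta>) = d \<xi> * \<eta> - \<xi> * d \<eta>"
  using d_wedge[of \<xi> 1 \<eta>] sub_forms[of 1] by auto

section \<open>Embedding the tensor products into the ambient algebra\<close>

sublocale pair: balanced_pair "(*)" "(*)" "\<Omega>A 0" "\<Omega>A n" L for n
  by unfold_locales
    (auto simp: subspace_add sub_subspace subspace_L act_A L_act[folded sub_forms_0])

abbreviation T where "T n \<equiv> balanced_tensor (*) (*) (\<Omega>A 0) (\<Omega>A n) L"
abbreviation ev where "ev \<equiv> formal_eval (\<lambda>(\<xi>, l). \<xi> * l)"

text \<open>A canonical form that depends only on the value \<open>ev u\<close>: expanding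
  \<open>l\<close> by the frame and moving \<open>l * c i\<close> across gives
  \<open>\<xi> \<otimes> l = \<Sum>i. \<xi> * l * c i \<otimes> c' i\<close>. Membership of
  \<open>ev u * c i\<close> belongs to the induction, since only then is the canonical form a formal
  sum on \<open>\<Omega>A n \<times> L\<close>.\<close>

lemma formal_sum_rel:
  assumes "Poly_Mapping.keys u \<subseteq> \<Omega>A n \<times> L"
  shows "(\<forall>i<N. ev u * c i \<in> \<Omega>A n) \<and> u - (\<Sum>i<N. frag_of (ev u * c i, c' i)) \<in> pair.rel n"
  using assms
proof (rule free_Abelian_group_induct)
  \<comment> \<open>Even \<open>u = 0\<close> needs an argument: its canonical form consists of the
    tensors \<open>0 \<otimes> c' i\<close>, and \<open>0 \<otimes> l\<close> is minus the relator
    for \<open>0 + 0\<close>.\<close>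
  have "frag_of (0, l) \<in> pair.rel n" if "l \<in> L" for l
    using pair.add_left_rel[of 0 n 0 l] pair.rel_minus that sub_subspace subspace_0 by fastforce
  then show "(\<forall>i<N. ev 0 * c i \<in> \<Omega>A n) \<and> 0 - (\<Sum>i<N. frag_of (ev 0 * c i, c' i)) \<in> pair.rel n"
    by (auto simp: subspace_0 sub_subspace c'_mem intro!: pair.rel_minus pair.rel_sum)
next
  fix p assume "p \<in> \<Omega>A n \<times> L"
  then obtain \<xi> l where p: "p = (\<xi>, l)" and \<xi>: "\<xi> \<in> \<Omega>A n" and l: "l \<in> L"
    by blast
  have zero: "frag_of (\<xi>, 0) \<in> pair.rel n"
    using pair.add_right_rel[of \<xi> n 0 0] pair.rel_minus[of "- frag_of (\<xi>, 0)" n] \<xi> subspace_0[OF subspace_L]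
    by simp
  \<comment> \<open>A relator splits only two summands, so a finite sum is split by induction;
    membership in \<open>L\<close> is carried along because each step uses it.\<close>
  have sum: "frag_of (\<xi>, \<Sum>i<k. x i) - (\<Sum>i<k. frag_of (\<xi>, x i)) \<in> pair.rel n \<and> (\<Sum>i<k. x i) \<in> L"
    if "\<And>i. i < k \<Longrightarrow> x i \<in> L" for k and x :: "nat \<Rightarrow> 'w"
    using that
  proof (induction k)
    case 0
    then show ?case by (simp add: zero subspace_0 subspace_L)
  next
    case (Suc k)
    then have IH: "frag_of (\<xi>, \<Sum>i<k. x i) - (\<Sum>i<k. frag_of (\<xi>, x i)) \<in> pair.rel n"
      and L: "(\<Sum>i<k. x i) \<in> L" "x k \<in> L"
      by auto
    from pair.rel_add[OF IH pair.add_right_rel[OF \<xi> L]] L show ?case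
      by (simp add: algebra_simps subspace_add subspace_L)
  qed
  \<comment> \<open>First expand \<open>l\<close> by the frame, then move the coefficients
    \<open>l * c i\<close>, which lie in \<open>A\<close>, across by the balancing relators.\<close>
  have "frag_of (\<xi>, l) - (\<Sum>i<N. frag_of (\<xi>, l * c i * c' i)) \<in> pair.rel n"
    using sum[of N "\<lambda>i. l * c i * c' i"] l by (simp add: sum_frame L_act L_mult_c c'_mem)
  moreover have "(\<Sum>i<N. frag_of (\<xi> * (l * c i), c' i) - frag_of (\<xi>, l * c i * c' i)) \<in> pair.rel n"
    by (intro pair.rel_sum pair.balanced_rel) (auto simp: \<xi> l L_mult_c_0 c'_mem)
  ultimately have "frag_of (\<xi>, l) - (\<Sum>i<N. frag_of (\<xi> * (l * c i), c' i)) \<in> pair.rel n"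
    by (drule_tac pair.rel_diff) (auto simp: sum_subtractf)
  then show "(\<forall>i<N. ev (frag_of p) * c i \<in> \<Omega>A n) \<and>
      frag_of p - (\<Sum>i<N. frag_of (ev (frag_of p) * c i, c' i)) \<in> pair.rel n"
    by (auto simp: p mult.assoc \<xi> l act_A L_mult_c_0)
next
  fix u v
  assume u: "(\<forall>i<N. ev u * c i \<in> \<Omega>A n) \<and> u - (\<Sum>i<N. frag_of (ev u * c i, c' i)) \<in> pair.rel n"
    and v: "(\<forall>i<N. ev v * c i \<in> \<Omega>A n) \<and> v - (\<Sum>i<N. frag_of (ev v * c i, c' i)) \<in> pair.rel n"
  have mem: "ev (u - v) * c i \<in> \<Omega>A n" if "i < N" for i
    using u v that by (simp add: left_diff_distrib subspace_diff sub_subspace)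
  \<comment> \<open>Relators split sums, so \<open>ev u * c i\<close> is written as
    \<open>ev (u - v) * c i + ev v * c i\<close>.\<close>
  have "(\<Sum>i<N. frag_of (ev (u - v) * c i + ev v * c i, c' i) - frag_of (ev (u - v) * c i, c' i)
      - frag_of (ev v * c i, c' i)) \<in> pair.rel n"
    using mem v by (intro pair.rel_sum pair.add_left_rel) (auto simp: c'_mem)
  then have "(\<Sum>i<N. frag_of (ev u * c i, c' i)) - (\<Sum>i<N. frag_of (ev (u - v) * c i, c' i))
      - (\<Sum>i<N. frag_of (ev v * c i, c' i)) \<in> pair.rel n"
    by (simp add: sum_subtractf left_diff_distrib)
  with u v have "(u - (\<Sum>i<N. frag_of (ev u * c i, c' i))) - (v - (\<Sum>i<N. frag_of (ev v * c i, c' i)))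
      + ((\<Sum>i<N. frag_of (ev u * c i, c' i)) - (\<Sum>i<N. frag_of (ev (u - v) * c i, c' i))
      - (\<Sum>i<N. frag_of (ev v * c i, c' i))) \<in> pair.rel n"
    by (intro pair.rel_add[OF pair.rel_diff]) auto
  moreover have "a - x - (b - y) + (x - z - y) = a - b - z" for a b x y z :: "('w \<times> 'w) formal_sum"
    by (simp add: algebra_simps)
  ultimately have "(u - v) - (\<Sum>i<N. frag_of (ev (u - v) * c i, c' i)) \<in> pair.rel n"
    by (simp only:)
  with mem show "(\<forall>i<N. ev (u - v) * c i \<in> \<Omega>A n) \<and>
      (u - v) - (\<Sum>i<N. frag_of (ev (u - v) * c i, c' i)) \<in> pair.rel n"
    by blast
qed

definition tensor_eval :: "('w \<times> 'w) formal_sum set \<Rightarrow> 'w"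
  where "tensor_eval = tensor_lift additive_group (\<lambda>(\<xi>, l). \<xi> * l)"

lemma tensor_eval_class:
  assumes "Poly_Mapping.keys u \<subseteq> \<Omega>A n \<times> L"
  shows "tensor_eval (tensor_class (T n) u) = ev u"
  unfolding tensor_eval_def formal_eval_def using assms
  by (intro pair.tensor_lift_class) (auto simp: distrib_left distrib_right mult.assoc)

text \<open>One direction is well-definedness of multiplication. For the other, both formal sums are
  congruent to the same canonical form.\<close>

lemma tensor_class_eq_iff:
  assumes "Poly_Mapping.keys u \<subseteq> \<Omega>A n \<times> L" "Poly_Mapping.keys v \<subseteq> \<Omega>A n \<times> L"
  shows "tensor_class (T n) u = tensor_class (T n) v \<longleftrightarrow> ev u = ev v"
proof
  assume "tensor_class (T n) u = tensor_class (T n) v"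
  then show "ev u = ev v"
    using tensor_eval_class assms by metis
next
  assume "ev u = ev v"
  moreover have canonical: "tensor_class (T n) w = tensor_class (T n) (\<Sum>i<N. frag_of (ev w * c i, c' i))"
    if "Poly_Mapping.keys w \<subseteq> \<Omega>A n \<times> L" for w
    using formal_sum_rel[OF that] by (intro pair.tensor_class_eqI) auto
  ultimately show "tensor_class (T n) u = tensor_class (T n) v"
    using canonical[OF assms(1)] canonical[OF assms(2)] by simp
qed

lemma carrierE:
  assumes "X \<in> carrier (T n)"
  obtains u where "Poly_Mapping.keys u \<subseteq> \<Omega>A n \<times> L" "X = tensor_class (T n) u"
  using assms pair.carrier_tensor by auto

text \<open>Equality of tensors thus reduces to equality in the ambient algebra; the identities for
  connections and curvature are proved this way.\<close>

lemma tensor_eval_inj: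
  "\<lbrakk>X \<in> carrier (T n); Y \<in> carrier (T n); tensor_eval X = tensor_eval Y\<rbrakk> \<Longrightarrow> X = Y"
  by (elim carrierE) (simp add: tensor_class_eq_iff tensor_eval_class)

lemma tensor_eval_mult:
  "\<lbrakk>X \<in> carrier (T n); Y \<in> carrier (T n)\<rbrakk> \<Longrightarrow> tensor_eval (X \<otimes>\<^bsub>T n\<^esub> Y) = tensor_eval X + tensor_eval Y"
proof (elim carrierE)
  fix u v
  assume u: "Poly_Mapping.keys u \<subseteq> \<Omega>A n \<times> L" "X = tensor_class (T n) u"
    and v: "Poly_Mapping.keys v \<subseteq> \<Omega>A n \<times> L" "Y = tensor_class (T n) v"
  have uv: "Poly_Mapping.keys (u + v) \<subseteq> \<Omega>A n \<times> L"
    using keys_add[of u v] u v by blast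
  show ?thesis
    using hom_mult[OF pair.tensor_class_hom, of u n v] u v tensor_eval_class[OF uv]
    by (simp add: tensor_eval_class)
qed

section \<open>Maps between tensor products, computed by their values\<close>

lemma comm_group_T: "comm_group (T n)"
  by (rule pair.comm_group_tensor)

lemma tensor_eval_hom: "tensor_eval \<in> hom (T n) additive_group"
  by (rule homI) (simp_all add: tensor_eval_mult)

lemma tensor_eval_inv:
  assumes "X \<in> carrier (T n)"
  shows "tensor_eval (inv\<^bsub>T n\<^esub> X) = - tensor_eval X"
proof -
  interpret group_hom "T n" additive_group tensor_eval
    using comm_group_T[of n] tensor_eval_hom[of n]
    by (simp add: group_hom_def group_hom_axioms_def comm_group.axioms)
  show ?thesis
    using hom_inv[OF assms] by simp
qed

text \<open>Since \<open>tensor_eval\<close> is injective on \<open>T n\<close>, it suffices to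
  check that the values \<open>q\<close> of \<open>f\<close> in the ambient algebra are biadditive
  and balanced.\<close>

lemma tensor_lift_eval:
  assumes f: "f \<in> \<Omega>A m \<times> L \<rightarrow> carrier (T n)"
    and q: "\<And>\<xi> l. \<lbrakk>\<xi> \<in> \<Omega>A m; l \<in> L\<rbrakk> \<Longrightarrow> tensor_eval (f (\<xi>, l)) = q (\<xi>, l)"
    and add_left: "\<And>\<xi> \<xi>' l. \<lbrakk>\<xi> \<in> \<Omega>A m; \<xi>' \<in> \<Omega>A m; l \<in> L\<rbrakk> \<Longrightarrow> q (\<xi> + \<xi>', l) = q (\<xi>, l) + q (\<xi>', l)"
    and add_right: "\<And>\<xi> l l'. \<lbrakk>\<xi> \<in> \<Omega>A m; l \<in> L; l' \<in> L\<rbrakk> \<Longrightarrow> q (\<xi>, l + l') = q (\<xi>, l) + q (\<xi>, l')"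
    and balanced: "\<And>\<xi> a l. \<lbrakk>\<xi> \<in> \<Omega>A m; a \<in> \<Omega>A 0; l \<in> L\<rbrakk> \<Longrightarrow> q (\<xi> * a, l) = q (\<xi>, a * l)"
    and u: "Poly_Mapping.keys u \<subseteq> \<Omega>A m \<times> L"
  shows "tensor_lift (T n) f (tensor_class (T m) u) \<in> carrier (T n)"
    and "tensor_eval (tensor_lift (T n) f (tensor_class (T m) u)) = formal_eval q u"
proof -
  interpret T: comm_group "T n" by (rule comm_group_T)
  note mem = funcset_mem[OF f]
  have lift: "tensor_lift (T n) f (tensor_class (T m) u) = formal_prod (T n) f u"
  proof (rule pair.tensor_lift_class[OF comm_group_T f _ _ _ u])
    fix \<xi> \<xi>' l assume "\<xi> \<in> \<Omega>A m" "\<xi>' \<in> \<Omega>A m" "l \<in> L"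
    then show "f (\<xi> + \<xi>', l) = f (\<xi>, l) \<otimes>\<^bsub>T n\<^esub> f (\<xi>', l)"
      by (intro tensor_eval_inj[of _ n])
        (simp_all add: mem tensor_eval_mult q add_left pair.add_left_mem)
  next
    fix \<xi> l l' assume "\<xi> \<in> \<Omega>A m" "l \<in> L" "l' \<in> L"
    then show "f (\<xi>, l + l') = f (\<xi>, l) \<otimes>\<^bsub>T n\<^esub> f (\<xi>, l')"
      by (intro tensor_eval_inj[of _ n])
        (simp_all add: mem tensor_eval_mult q add_right pair.add_right_mem)
  next
    fix \<xi> a l assume "\<xi> \<in> \<Omega>A m" "a \<in> \<Omega>A 0" "l \<in> L"
    then show "f (\<xi> * a, l) = f (\<xi>, a * l)"
      by (intro tensor_eval_inj[of _ n])
        (simp_all add: mem q balanced pair.ract_mem pair.lact_mem)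
  qed
  note hom = T.formal_prod_hom[OF f]
  show "tensor_lift (T n) f (tensor_class (T m) u) \<in> carrier (T n)"
    using lift hom_in_carrier[OF hom] u by simp
  \<comment> \<open>Evaluation after the lift is a homomorphism on formal sums that agrees with
    \<open>q\<close> on generators, which determines it.\<close>
  interpret group_hom "free_Abelian_group (\<Omega>A m \<times> L)" additive_group "tensor_eval \<circ> formal_prod (T n) f"
    using hom_compose[OF hom tensor_eval_hom] by (simp add: group_hom_def group_hom_axioms_def)
  have diff: "(tensor_eval \<circ> formal_prod (T n) f) (v - w) =
      (tensor_eval \<circ> formal_prod (T n) f) v - (tensor_eval \<circ> formal_prod (T n) f) w"
    if "Poly_Mapping.keys v \<subseteq> \<Omega>A m \<times> L" "Poly_Mapping.keys w \<subseteq> \<Omega>A m \<times> L" for v w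
    using hom_mult[of v "- w"] hom_inv[of w] that by simp
  have "(tensor_eval \<circ> formal_prod (T n) f) u = formal_eval q u"
  proof (rule formal_eval_unique[where h = "tensor_eval \<circ> formal_prod (T n) f", OF u _ diff])
    fix p assume "p \<in> \<Omega>A m \<times> L"
    then show "(tensor_eval \<circ> formal_prod (T n) f) (frag_of p) = q p"
      using q by (auto simp: T.formal_prod_frag_of mem)
  qed (use hom_one in auto)
  then show "tensor_eval (tensor_lift (T n) f (tensor_class (T m) u)) = formal_eval q u"
    by (simp add: lift)
qed

text \<open>\<open>F\<close> commutes with right multiplication, so \<open>F \<xi> * l\<close> is
  balanced. Two degrees \<open>m\<close> and \<open>n\<close> occur because left multiplication by a
  one-form raises the degree, while scalars and elements of \<open>A\<close> keep it.\<close>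

lemma tensor_map_left_eval:
  assumes F: "\<And>\<xi>. \<xi> \<in> \<Omega>A m \<Longrightarrow> F \<xi> \<in> \<Omega>A n" "\<And>x y. F (x + y) = F x + F y" "\<And>x y. F (x * y) = F x * y"
    and X: "X \<in> carrier (T m)"
  shows "tensor_map_left (T n) F X \<in> carrier (T n)"
    and "tensor_eval (tensor_map_left (T n) F X) = F (tensor_eval X)"
proof -
  obtain u where u: "Poly_Mapping.keys u \<subseteq> \<Omega>A m \<times> L" "X = tensor_class (T m) u"
    using X by (rule carrierE)
  have F0: "F 0 = 0"
    using F(2)[of 0 0] by simp
  have F_diff: "F (x - y) = F x - F y" for x y
    using F(2)[of "x - y" y] by simp
  define q where "q = (\<lambda>(\<xi>, l). F \<xi> * l)"
  note lift = tensor_lift_eval[where q = q and n = n and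
      f = "\<lambda>(\<xi>, l). tensor_class (T n) (frag_of (F \<xi>, l))", OF _ _ _ _ _ u(1)]
  show "tensor_map_left (T n) F X \<in> carrier (T n)"
    unfolding tensor_map_left_def u(2)
    by (rule lift) (auto simp: q_def F tensor_eval_class pair.tensor_class_mem algebra_simps)
  have "tensor_eval (tensor_map_left (T n) F X) = formal_eval q u"
    unfolding tensor_map_left_def u(2)
    by (rule lift) (auto simp: q_def F tensor_eval_class pair.tensor_class_mem algebra_simps)
  also have "\<dots> = F (ev u)"
    by (rule formal_eval_unique[where h = "\<lambda>u. F (ev u)", OF u(1), symmetric]) (auto simp: F0 F_diff F q_def)
  finally show "tensor_eval (tensor_map_left (T n) F X) = F (tensor_eval X)"
    by (simp add: u tensor_eval_class)
qed

section \<open>The covariant derivative given by the frame\<close>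

declare One_nat_def [simp del]

text \<open>The Grassmann connection of the dual basis \<open>c\<close>, \<open>c'\<close>, that is
  \<open>d (e c) \<otimes> c'\<close>, after multiplying out.\<close>

definition frame_d :: "'w \<Rightarrow> 'w"
  where "frame_d e = (\<Sum>i<N. d (e * c i) * c' i)"

definition connection_sum :: "'w \<Rightarrow> 'w \<Rightarrow> ('w \<times> 'w) formal_sum"
  where "connection_sum \<zeta> e =
    (\<Sum>i<N. frag_of (d (e * c i), c' i)) + (\<Sum>i<N. frag_of (e * \<zeta> * c i, c' i))"

lemma frame_d_add: "frame_d (e + e') = frame_d e + frame_d e'"
  by (simp add: frame_d_def distrib_right d_add sum.distrib)

lemma frame_d_scale: "frame_d (scale r e) = scale r (frame_d e)"
  by (simp add: frame_d_def scale_mult_left d_scale scale_sum_right)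

lemma A_subset: "a \<in> \<Omega>A 0 \<Longrightarrow> a \<in> \<Omega> 0"
  using sub_forms by blast

text \<open>In the Leibniz expansion of \<open>d (a * (l * c i))\<close> the terms containing
  \<open>d a\<close> recombine to \<open>d a * l\<close> by the frame expansion of
  \<open>l\<close>.\<close>

lemma frame_d_mult:
  assumes "a \<in> \<Omega>A 0"
  shows "frame_d (a * l) = d a * l + a * frame_d l"
proof -
  have "d (a * l * c i) * c' i = d a * l * c i * c' i + a * (d (l * c i) * c' i)" for i
    using d_mult[OF A_subset[OF assms], of "l * c i"] by (simp add: algebra_simps)
  then show ?thesis
    by (simp add: frame_d_def sum.distrib sum_frame sum_distrib_left)
qed

text \<open>The Leibniz rule for \<open>e * c j\<close> times \<open>c' j * x\<close>, summed over
  the frame. The hypothesis concerns \<open>e * c j\<close>, so that \<open>e\<close> may be an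
  element of \<open>L\<close> or the unit.\<close>

lemma sum_mult_d_frame:
  assumes "\<And>j. j < N \<Longrightarrow> e * c j \<in> \<Omega> 0"
  shows "(\<Sum>j<N. e * c j * d (c' j * x)) = d (e * x) - frame_d e * x"
proof -
  have "e * c j * d (c' j * x) = d (e * c j * (c' j * x)) - d (e * c j) * c' j * x" if "j < N" for j
    using d_mult[OF assms[OF that]] by (simp add: mult.assoc)
  moreover have "(\<Sum>j<N. e * c j * (c' j * x)) = e * x"
    using sum_frame[of e] by (simp add: mult.assoc[symmetric] flip: sum_distrib_right)
  ultimately show ?thesis
    by (simp add: sum_subtractf frame_d_def sum_distrib_right flip: d_sum)
qed

text \<open>The identity \<open>c d(c' h) h' = 0\<close>. The preceding lemma at
  \<open>e = unt\<close>, \<open>x = c j\<close>, multiplied by \<open>c' j\<close> and summed over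
  \<open>j\<close>, leaves \<open>frame_d unt - frame_d unt\<close>. It removes the frame part from
  the potential, a mixed term from the curvature, and the difference between the two curvature
  formulas.\<close>

lemma sum_mult_frame_d: "(\<Sum>i<N. c i * frame_d (c' i)) = 0"
proof -
  have 1: "(\<Sum>i<N. c i * d (c' i * x)) = d x - frame_d unt * x" for x
    using sum_mult_d_frame[of unt x] c_mem by (simp add: unit_left forms_0)
  have "(\<Sum>i<N. c i * frame_d (c' i)) = (\<Sum>j<N. (\<Sum>i<N. c i * d (c' i * c j)) * c' j)"
    unfolding frame_d_def sum_distrib_left sum_distrib_right
    by (subst sum.swap) (simp add: mult.assoc)
  also have "\<dots> = (\<Sum>j<N. d (c j) * c' j) - frame_d unt * (\<Sum>j<N. c j * c' j)"
    by (simp add: 1 left_diff_distrib sum_subtractf sum_distrib_left mult.assoc)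
  finally show ?thesis
    by (simp add: frame_unit unit_right) (simp add: frame_d_def unit_left)
qed

section \<open>Covariant derivatives and their potentials\<close>

lemma keys_frame_d_sum: "e \<in> L \<Longrightarrow> Poly_Mapping.keys (\<Sum>i<N. frag_of (d (e * c i), c' i)) \<subseteq> \<Omega>A 1 \<times> L"
  by (intro keys_sum_subset) (auto simp: c'_mem d_0_mem L_mult_c_0)

lemma ev_frame_d_sum: "ev (\<Sum>i<N. frag_of (d (e * c i), c' i)) = frame_d e"
  by (simp add: frame_d_def)

lemma keys_potential_sum:
  "\<lbrakk>\<zeta> \<in> \<Omega>A 1; e \<in> L\<rbrakk> \<Longrightarrow> Poly_Mapping.keys (\<Sum>i<N. frag_of (e * \<zeta> * c i, c' i)) \<subseteq> \<Omega>A 1 \<times> L"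
  by (intro keys_sum_subset) (use c'_mem sandwich_L in auto)

lemma ev_potential_sum: "ev (\<Sum>i<N. frag_of (e * \<zeta> * c i, c' i)) = e * \<zeta>"
  by (simp add: sum_frame)

lemma keys_connection_sum:
  "\<lbrakk>\<zeta> \<in> \<Omega>A 1; e \<in> L\<rbrakk> \<Longrightarrow> Poly_Mapping.keys (connection_sum \<zeta> e) \<subseteq> \<Omega>A 1 \<times> L"
  unfolding connection_sum_def by (intro keys_add_subset keys_frame_d_sum keys_potential_sum)

lemma ev_connection_sum: "ev (connection_sum \<zeta> e) = frame_d e + e * \<zeta>"
  unfolding connection_sum_def by (simp only: formal_eval_add ev_frame_d_sum ev_potential_sum)

text \<open>The value of \<open>X\<close> is an integer combination of products
  \<open>\<xi> * l\<close>, and each \<open>c i * \<xi> * l\<close> is a one-form on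
  \<open>A\<close>. This is what places the potential in \<open>\<Omega>A 1\<close>.\<close>

lemma sandwich_eval:
  assumes "X \<in> carrier (T 1)" "i < N"
  shows "c i * tensor_eval X \<in> \<Omega>A 1"
proof -
  obtain u where u: "Poly_Mapping.keys u \<subseteq> \<Omega>A 1 \<times> L" "X = tensor_class (T 1) u"
    using assms(1) by (rule carrierE)
  have "c i * ev u \<in> \<Omega>A 1"
    using u(1)
  proof (rule free_Abelian_group_induct)
    fix p assume "p \<in> \<Omega>A 1 \<times> L"
    then show "c i * ev (frag_of p) \<in> \<Omega>A 1"
      using sandwich_c[OF assms(2)] by (auto simp: mult.assoc)
  qed (auto simp: right_diff_distrib subspace_diff subspace_0 sub_subspace)
  then show ?thesis
    by (simp add: u tensor_eval_class)
qed

text \<open>Each axiom becomes an identity in the ambient algebra by injectivity of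
  \<open>tensor_eval\<close>, which is available once \<open>D\<close> takes its values in the
  carrier; otherwise both sides fail.\<close>

lemma left_covariant_derivative_iff:
  "left_covariant_derivative scale d \<Omega>A L D \<longleftrightarrow>
    (\<forall>e\<in>L. D e \<in> carrier (T 1)) \<and>
    (\<forall>e\<in>L. \<forall>e'\<in>L. tensor_eval (D (e + e')) = tensor_eval (D e) + tensor_eval (D e')) \<and>
    (\<forall>r. \<forall>e\<in>L. tensor_eval (D (scale r e)) = scale r (tensor_eval (D e))) \<and>
    (\<forall>a\<in>\<Omega>A 0. \<forall>e\<in>L. tensor_eval (D (a * e)) = d a * e + a * tensor_eval (D e))"
proof -
  interpret T: comm_group "T 1" by (rule comm_group_T)
  show ?thesis
  proof (cases "\<forall>e\<in>L. D e \<in> carrier (T 1)")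
    case True
    have eq: "X = Y \<longleftrightarrow> tensor_eval X = tensor_eval Y" if "X \<in> carrier (T 1)" "Y \<in> carrier (T 1)" for X Y
      using that tensor_eval_inj by blast
    have add: "D (e + e') = D e \<otimes>\<^bsub>T 1\<^esub> D e' \<longleftrightarrow>
        tensor_eval (D (e + e')) = tensor_eval (D e) + tensor_eval (D e')" if "e \<in> L" "e' \<in> L" for e e'
      using that True by (subst eq) (auto intro: T.m_closed simp: tensor_eval_mult subspace_add[OF subspace_L])
    have scale: "D (scale r e) = tensor_map_left (T 1) (scale r) (D e) \<longleftrightarrow>
        tensor_eval (D (scale r e)) = scale r (tensor_eval (D e))" if "e \<in> L" for r e
    proof -
      have "D e \<in> carrier (T 1)"
        using True that by blast
      note map = tensor_map_left_eval[of 1 "scale r" 1, OF _ _ _ this]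
      show ?thesis
        using that True map
        by (subst eq) (auto simp: subspace_scale[OF subspace_L] subspace_scale[OF sub_subspace]
          scale_right_distrib scale_mult_left)
    qed
    have mult: "D (a * e) = tensor_class (T 1) (frag_of (d a, e)) \<otimes>\<^bsub>T 1\<^esub> tensor_map_left (T 1) ((*) a) (D e) \<longleftrightarrow>
        tensor_eval (D (a * e)) = d a * e + a * tensor_eval (D e)" if "a \<in> \<Omega>A 0" "e \<in> L" for a e
    proof -
      have "D e \<in> carrier (T 1)"
        using True that by blast
      note map = tensor_map_left_eval[of 1 "(*) a" 1, OF _ _ _ this]
      have "tensor_map_left (T 1) ((*) a) (D e) \<in> carrier (T 1)"
        "tensor_eval (tensor_map_left (T 1) ((*) a) (D e)) = a * tensor_eval (D e)"
        by (rule map; simp add: A_act that distrib_left mult.assoc)+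
      moreover have "Poly_Mapping.keys (frag_of (d a, e)) \<subseteq> \<Omega>A 1 \<times> L"
        using that d_0_mem by simp
      moreover have "D (a * e) \<in> carrier (T 1)"
        using True that L_act sub_forms_0 by blast
      ultimately show ?thesis
        by (subst eq) (simp_all add: tensor_eval_mult tensor_eval_class pair.tensor_class_mem)
    qed
    show ?thesis
      using True add scale mult
      by (simp add: left_covariant_derivative_def forms_tensor_def Let_def Pi_iff)
  qed (auto simp: left_covariant_derivative_def forms_tensor_def Let_def)
qed

text \<open>Covariant derivatives form an affine space over the left \<open>A\<close>-linear maps
  from \<open>L\<close> to the tensor product. The frame supplies a base point, and every such
  linear map has the value \<open>e * \<zeta>\<close>.\<close>

proposition left_covariant_derivative_iff_potential:
  "left_covariant_derivative scale d \<Omega>A L D \<longleftrightarrow>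
    (\<exists>\<zeta>\<in>\<Omega>A 1. \<forall>e\<in>L. D e = tensor_class (T 1) (connection_sum \<zeta> e))"
proof
  assume "left_covariant_derivative scale d \<Omega>A L D"
  then have mem: "\<And>e. e \<in> L \<Longrightarrow> D e \<in> carrier (T 1)"
    and add: "\<And>e e'. \<lbrakk>e \<in> L; e' \<in> L\<rbrakk> \<Longrightarrow> tensor_eval (D (e + e')) = tensor_eval (D e) + tensor_eval (D e')"
    and mult: "\<And>a e. \<lbrakk>a \<in> \<Omega>A 0; e \<in> L\<rbrakk> \<Longrightarrow> tensor_eval (D (a * e)) = d a * e + a * tensor_eval (D e)"
    by (simp_all add: left_covariant_derivative_iff)
  define \<gamma> where "\<gamma> e = tensor_eval (D e) - frame_d e" for e
  have \<gamma>_add: "\<gamma> (e + e') = \<gamma> e + \<gamma> e'" if "e \<in> L" "e' \<in> L" for e e'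
    using that by (simp add: \<gamma>_def add frame_d_add)
  have \<gamma>_mult: "\<gamma> (a * e) = a * \<gamma> e" if "a \<in> \<Omega>A 0" "e \<in> L" for a e
    using that by (simp add: \<gamma>_def mult frame_d_mult right_diff_distrib)
  have L0: "0 \<in> L"
    by (rule subspace_0[OF subspace_L])
  \<comment> \<open>\<open>\<gamma>\<close> is additive only on \<open>L\<close>, so the induction
    also keeps the partial sums in \<open>L\<close>.\<close>
  have \<gamma>_sum: "\<gamma> (\<Sum>i<k. x i) = (\<Sum>i<k. \<gamma> (x i)) \<and> (\<Sum>i<k. x i) \<in> L"
    if "\<And>i. i < k \<Longrightarrow> x i \<in> L" for x and k :: nat
    using that
  proof (induction k)
    case 0
    then show ?case using \<gamma>_add[OF L0 L0] L0 by simp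
  next
    case (Suc k)
    then show ?case by (simp add: \<gamma>_add subspace_add[OF subspace_L])
  qed
  define \<zeta> where "\<zeta> = (\<Sum>i<N. c i * \<gamma> (c' i))"
  \<comment> \<open>The \<open>frame_d\<close> part of \<zeta> vanishes by
    \<open>sum_mult_frame_d\<close>; what is left is in \<open>\<Omega>A 1\<close> term by
    term.\<close>
  have "(\<Sum>i<N. c i * tensor_eval (D (c' i))) \<in> \<Omega>A 1"
    by (intro subspace_sum sub_subspace sandwich_eval mem c'_mem) auto
  then have \<zeta>: "\<zeta> \<in> \<Omega>A 1"
    using sum_mult_frame_d by (simp add: \<zeta>_def \<gamma>_def right_diff_distrib sum_subtractf)
  have "e * \<zeta> = \<gamma> e" if "e \<in> L" for e
  proof -
    have "e * \<zeta> = (\<Sum>i<N. \<gamma> (e * c i * c' i))"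
      using that by (simp add: \<zeta>_def sum_distrib_left \<gamma>_mult L_mult_c_0 c'_mem mult.assoc[symmetric])
    also have "\<dots> = \<gamma> (\<Sum>i<N. e * c i * c' i)"
      using that \<gamma>_sum[of N "\<lambda>i. e * c i * c' i"] by (simp add: L_act L_mult_c c'_mem)
    finally show ?thesis
      by (simp add: sum_frame)
  qed
  then have "D e = tensor_class (T 1) (connection_sum \<zeta> e)" if "e \<in> L" for e
    using that keys_connection_sum[OF \<zeta> that]
    by (intro tensor_eval_inj[of _ 1])
      (simp_all add: mem pair.tensor_class_mem tensor_eval_class ev_connection_sum \<gamma>_def)
  with \<zeta> show "\<exists>\<zeta>\<in>\<Omega>A 1. \<forall>e\<in>L. D e = tensor_class (T 1) (connection_sum \<zeta> e)"
    by blast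
next
  assume "\<exists>\<zeta>\<in>\<Omega>A 1. \<forall>e\<in>L. D e = tensor_class (T 1) (connection_sum \<zeta> e)"
  then obtain \<zeta> where \<zeta>: "\<zeta> \<in> \<Omega>A 1" and D: "\<And>e. e \<in> L \<Longrightarrow> D e = tensor_class (T 1) (connection_sum \<zeta> e)"
    by blast
  have eval: "D e \<in> carrier (T 1) \<and> tensor_eval (D e) = frame_d e + e * \<zeta>" if "e \<in> L" for e
    using that keys_connection_sum[OF \<zeta> that]
    by (simp add: D pair.tensor_class_mem tensor_eval_class ev_connection_sum)
  \<comment> \<open>The added term \<open>e * \<zeta>\<close> is left \<open>A\<close>-linear in
    \<open>e\<close>, so the Leibniz rule of \<open>frame_d\<close> survives.\<close>
  show "left_covariant_derivative scale d \<Omega>A L D"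
    unfolding left_covariant_derivative_iff
    by (auto simp: eval subspace_add[OF subspace_L] subspace_scale[OF subspace_L] L_act[folded sub_forms_0]
      frame_d_add frame_d_scale frame_d_mult scale_mult_left algebra_simps)
qed

section \<open>Curvature\<close>

lemma curvature_eval:
  assumes \<zeta>: "\<zeta> \<in> \<Omega>A 1" and D: "\<forall>e\<in>L. D e = tensor_class (T 1) (connection_sum \<zeta> e)" and e: "e \<in> L"
  shows "curvature d \<Omega>A L D e \<in> carrier (T 2)"
    and "tensor_eval (curvature d \<Omega>A L D e) =
      (\<Sum>j<N. \<Sum>i<N. e * c j * d (c' j * \<zeta> * c i) * c' i)
      - (\<Sum>i<N. d (e * c i) * frame_d (c' i)) - e * \<zeta> * \<zeta>"
proof -
  interpret T: comm_group "T 2" by (rule comm_group_T)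
  define q where "q = (\<lambda>(\<xi>, l). d \<xi> * l - \<xi> * (frame_d l + l * \<zeta>))"
  define f where "f = (\<lambda>(\<xi>, l). tensor_class (T 2) (frag_of (d \<xi>, l)) \<otimes>\<^bsub>T 2\<^esub>
    inv\<^bsub>T 2\<^esub> tensor_map_left (T 2) ((*) \<xi>) (D l))"
  have f: "f (\<xi>, l) \<in> carrier (T 2) \<and> tensor_eval (f (\<xi>, l)) = q (\<xi>, l)" if "\<xi> \<in> \<Omega>A 1" "l \<in> L" for \<xi> l
  proof -
    have D_l: "D l \<in> carrier (T 1)" "tensor_eval (D l) = frame_d l + l * \<zeta>"
      using that keys_connection_sum[OF \<zeta>, of l]
      by (simp_all add: D pair.tensor_class_mem tensor_eval_class ev_connection_sum)
    have "tensor_map_left (T 2) ((*) \<xi>) (D l) \<in> carrier (T 2)"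
      "tensor_eval (tensor_map_left (T 2) ((*) \<xi>) (D l)) = \<xi> * tensor_eval (D l)"
      by (rule tensor_map_left_eval[of 1 "(*) \<xi>" 2, OF _ _ _ D_l(1)];
          simp add: wedge_1_1[OF that(1)] distrib_left mult.assoc)+
    moreover have "Poly_Mapping.keys (frag_of (d \<xi>, l)) \<subseteq> \<Omega>A 2 \<times> L"
      using that d_1_mem by simp
    ultimately show ?thesis
      by (simp add: f_def q_def tensor_eval_mult tensor_eval_inv tensor_eval_class pair.tensor_class_mem D_l)
  qed
  note keys = keys_connection_sum[OF \<zeta> e]
  have q_left: "q (\<xi> + \<xi>', l) = q (\<xi>, l) + q (\<xi>', l)" for \<xi> \<xi>' l
    by (simp add: q_def d_add algebra_simps)
  have q_right: "q (\<xi>, l + l') = q (\<xi>, l) + q (\<xi>, l')" for \<xi> l l'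
    by (simp add: q_def frame_d_add algebra_simps)
  \<comment> \<open>Differentiating the one-form in \<open>\<xi> * a\<close> gives
    \<open>- \<xi> * d a * l\<close>; the Leibniz rule for \<open>a * l\<close> gives the same term
    with the same sign. Hence the curvature expression descends to the tensor product over
    \<open>A\<close>.\<close>
  have q_balanced: "q (\<xi> * a, l) = q (\<xi>, a * l)" if "\<xi> \<in> \<Omega>A 1" "a \<in> \<Omega>A 0" for \<xi> a l
    using that by (simp add: q_def d_mult_1 frame_d_mult algebra_simps)
  have curv: "curvature d \<Omega>A L D e = tensor_lift (T 2) f (tensor_class (T 1) (connection_sum \<zeta> e))"
    by (simp add: curvature_def forms_tensor_def f_def D e Let_def)
  have f_Pi: "f \<in> \<Omega>A 1 \<times> L \<rightarrow> carrier (T 2)"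
    using f by auto
  note lift = tensor_lift_eval[where q = q, OF f_Pi _ q_left q_right q_balanced keys]
  show "curvature d \<Omega>A L D e \<in> carrier (T 2)"
    unfolding curv using f by (intro lift) auto
  have "tensor_eval (curvature d \<Omega>A L D e) = formal_eval q (connection_sum \<zeta> e)"
    unfolding curv using f by (intro lift) auto
  \<comment> \<open>The terms \<open>d (d (e * c i))\<close> vanish, and the products
    \<open>d (e * c i) * c' i * \<zeta>\<close> sum to \<open>frame_d e * \<zeta>\<close>.\<close>
  also have "\<dots> = (\<Sum>i<N. d (e * \<zeta> * c i) * c' i) - (\<Sum>i<N. d (e * c i) * frame_d (c' i))
      - frame_d e * \<zeta> - e * \<zeta> * (\<Sum>i<N. c i * frame_d (c' i)) - e * \<zeta> * (\<Sum>i<N. c i * c' i) * \<zeta>"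
    by (simp add: connection_sum_def q_def d_d frame_d_def[of e] sum_subtractf sum.distrib sum_negf
        sum_distrib_left sum_distrib_right algebra_simps)
  finally have eval: "tensor_eval (curvature d \<Omega>A L D e) =
      (\<Sum>i<N. d (e * \<zeta> * c i) * c' i) - (\<Sum>i<N. d (e * c i) * frame_d (c' i))
      - frame_d e * \<zeta> - e * \<zeta> * (\<Sum>i<N. c i * frame_d (c' i)) - e * \<zeta> * (\<Sum>i<N. c i * c' i) * \<zeta>" .
  \<comment> \<open>A second copy of the frame is inserted after \<open>e\<close>. The correction
    \<open>frame_d e * \<zeta>\<close> cancels the mixed term of the previous formula.\<close>
  have leibniz: "(\<Sum>i<N. d (e * \<zeta> * c i) * c' i) =
      (\<Sum>i<N. (\<Sum>j<N. e * c j * d (c' j * (\<zeta> * c i))) * c' i) + frame_d e * \<zeta>"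
  proof -
    have "(\<Sum>j<N. e * c j * d (c' j * x)) = d (e * x) - frame_d e * x" for x
      using e by (intro sum_mult_d_frame A_subset L_mult_c_0)
    moreover have "(\<Sum>i<N. frame_d e * (\<zeta> * c i) * c' i) = frame_d e * \<zeta>"
      using sum_frame[of "frame_d e * \<zeta>"] by (simp add: mult.assoc)
    ultimately show ?thesis
      by (simp add: left_diff_distrib sum_subtractf mult.assoc)
  qed
  have interchange: "(\<Sum>i<N. (\<Sum>j<N. e * c j * d (c' j * (\<zeta> * c i))) * c' i) =
      (\<Sum>j<N. \<Sum>i<N. e * c j * d (c' j * \<zeta> * c i) * c' i)"
    unfolding sum_distrib_right by (subst sum.swap) (simp add: mult.assoc)
  show "tensor_eval (curvature d \<Omega>A L D e) =
      (\<Sum>j<N. \<Sum>i<N. e * c j * d (c' j * \<zeta> * c i) * c' i)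
      - (\<Sum>i<N. d (e * c i) * frame_d (c' i)) - e * \<zeta> * \<zeta>"
    unfolding eval leibniz interchange sum_mult_frame_d frame_unit unit_right by simp
qed

text \<open>The middle terms of the two curvature formulas agree: summing \<open>e f d(f' c)\<close>
  over the outer frame gives \<open>d (e c)\<close> minus \<open>frame_d e * c\<close>, and the
  latter is annihilated by \<open>sum_mult_frame_d\<close>.\<close>

lemma sum_mult_d_frame_d:
  assumes "e \<in> L"
  shows "(\<Sum>k<N. \<Sum>i<N. \<Sum>j<N. e * c k * d (c' k * c i) * d (c' i * c j) * c' j) =
    (\<Sum>i<N. d (e * c i) * frame_d (c' i))"
proof -
  have "(\<Sum>k<N. \<Sum>i<N. \<Sum>j<N. e * c k * d (c' k * c i) * d (c' i * c j) * c' j) =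
      (\<Sum>i<N. (\<Sum>k<N. e * c k * d (c' k * c i)) * frame_d (c' i))"
    unfolding sum_distrib_right
    by (subst sum.swap) (simp add: frame_d_def sum_distrib_left mult.assoc)
  also have "\<dots> = (\<Sum>i<N. (d (e * c i) - frame_d e * c i) * frame_d (c' i))"
    using assms by (simp add: sum_mult_d_frame A_subset L_mult_c_0)
  also have "\<dots> = (\<Sum>i<N. d (e * c i) * frame_d (c' i)) - frame_d e * (\<Sum>i<N. c i * frame_d (c' i))"
    by (simp add: left_diff_distrib sum_subtractf sum_distrib_left mult.assoc)
  finally show ?thesis
    by (simp add: sum_mult_frame_d)
qed

text \<open>Both formal sums have the value found in \<open>curvature_eval\<close>. Injectivity then
  applies because every summand pairs a two-form on \<open>A\<close> with an element of
  \<open>L\<close>.\<close>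

proposition curvature_formulas:
  assumes \<zeta>: "\<zeta> \<in> \<Omega>A 1" and D: "\<forall>e\<in>L. D e = tensor_class (T 1) (connection_sum \<zeta> e)" and e: "e \<in> L"
  shows "curvature d \<Omega>A L D e =
      tensor_class (T 2)
        ((\<Sum>j<N. \<Sum>i<N. frag_of (e * c j * d (c' j * \<zeta> * c i), c' i)) -
         (\<Sum>k<N. \<Sum>i<N. \<Sum>j<N. frag_of (e * c k * d (c' k * c i) * d (c' i * c j), c' j)) -
         (\<Sum>i<N. \<Sum>j<N. frag_of (e * \<zeta> * c i * (c' i * \<zeta> * c j), c' j)))" (is "_ = tensor_class _ ?U")
    and "curvature d \<Omega>A L D e =
      tensor_class (T 2)
        ((\<Sum>j<N. \<Sum>i<N. frag_of (e * c j * d (c' j * \<zeta> * c i), c' i)) -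
         (\<Sum>i<N. \<Sum>j<N. frag_of (d (e * c i) * d (c' i * c j), c' j)) -
         (\<Sum>i<N. \<Sum>j<N. frag_of (e * \<zeta> * c i * (c' i * \<zeta> * c j), c' j)))" (is "_ = tensor_class _ ?V")
proof -
  have d1: "d (l * c i) \<in> \<Omega>A 1" if "l \<in> L" "i < N" for l i
    using that by (intro d_0_mem L_mult_c_0)
  have mem1: "e * c j * d (c' j * \<zeta> * c i) \<in> \<Omega>A 2" if "i < N" "j < N" for i j
    using that by (intro A_act L_mult_c_0 d_1_mem sandwich_L c'_mem e \<zeta>)
  have mem2: "e * c k * d (c' k * c i) * d (c' i * c j) \<in> \<Omega>A 2" if "i < N" "j < N" "k < N" for i j k
    using that by (intro wedge_1_1 A_act L_mult_c_0 d1 c'_mem e)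
  \<comment> \<open>The bracketing exhibits two one-forms on \<open>A\<close>: the sandwich
    condition applies once to \<open>e\<close> and once to \<open>c' i\<close>.\<close>
  have mem3: "e * \<zeta> * c i * (c' i * \<zeta> * c j) \<in> \<Omega>A 2" if "i < N" "j < N" for i j
    using that by (intro wedge_1_1 sandwich_L c'_mem e \<zeta>)
  have mem4: "d (e * c i) * d (c' i * c j) \<in> \<Omega>A 2" if "i < N" "j < N" for i j
    using that by (intro wedge_1_1 d1 c'_mem e)
  have keys: "Poly_Mapping.keys ?U \<subseteq> \<Omega>A 2 \<times> L" "Poly_Mapping.keys ?V \<subseteq> \<Omega>A 2 \<times> L"
    by (intro keys_diff_subset keys_sum_subset; simp add: mem1 mem2 mem3 mem4 c'_mem)+
  \<comment> \<open>The frame expansion collapses the sum over \<open>j\<close> first and then the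
    sum over \<open>i\<close>.\<close>
  have square: "(\<Sum>i<N. \<Sum>j<N. e * \<zeta> * c i * (c' i * \<zeta> * c j) * c' j) = e * \<zeta> * \<zeta>"
  proof -
    have "(\<Sum>j<N. e * \<zeta> * c i * (c' i * \<zeta> * c j) * c' j) = e * \<zeta> * c i * c' i * \<zeta>" for i
      using sum_frame[of "e * \<zeta> * c i * c' i * \<zeta>"] by (simp add: mult.assoc)
    then show ?thesis
      using sum_frame[of "e * \<zeta>"] by (simp flip: sum_distrib_right)
  qed
  have frame: "(\<Sum>i<N. \<Sum>j<N. d (e * c i) * d (c' i * c j) * c' j) = (\<Sum>i<N. d (e * c i) * frame_d (c' i))"
    by (simp add: frame_d_def sum_distrib_left mult.assoc)
  note curv = curvature_eval[OF \<zeta> D e]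
  show "curvature d \<Omega>A L D e = tensor_class (T 2) ?U"
  proof (rule tensor_eval_inj[OF curv(1) pair.tensor_class_mem[OF keys(1)]])
    show "tensor_eval (curvature d \<Omega>A L D e) = tensor_eval (tensor_class (T 2) ?U)"
      unfolding tensor_eval_class[OF keys(1)] curv(2)
      by (simp add: sum_mult_d_frame_d[OF e] square)
  qed
  show "curvature d \<Omega>A L D e = tensor_class (T 2) ?V"
  proof (rule tensor_eval_inj[OF curv(1) pair.tensor_class_mem[OF keys(2)]])
    show "tensor_eval (curvature d \<Omega>A L D e) = tensor_eval (tensor_class (T 2) ?V)"
      unfolding tensor_eval_class[OF keys(2)] curv(2) by (simp add: frame square)
  qed
qed

text \<open>Left cancellation in the group \<open>T 1\<close>. It translates between a covariant
  derivative and its deviation \<open>\<Gamma>\<close> from the frame connection.\<close>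

lemma potential_iff:
  assumes \<zeta>: "\<zeta> \<in> \<Omega>A 1" and e: "e \<in> L" and X: "X \<in> carrier (T 1)"
  shows "tensor_class (T 1) (\<Sum>i<N. frag_of (d (e * c i), c' i)) \<otimes>\<^bsub>T 1\<^esub> X = tensor_class (T 1) (connection_sum \<zeta> e)
    \<longleftrightarrow> X = tensor_class (T 1) (\<Sum>i<N. frag_of (e * \<zeta> * c i, c' i))"
proof -
  interpret comm_group "T 1" by (rule comm_group_T)
  note keys = keys_frame_d_sum[OF e] keys_potential_sum[OF \<zeta> e]
  have "tensor_class (T 1) (connection_sum \<zeta> e) =
      tensor_class (T 1) (\<Sum>i<N. frag_of (d (e * c i), c' i)) \<otimes>\<^bsub>T 1\<^esub>
      tensor_class (T 1) (\<Sum>i<N. frag_of (e * \<zeta> * c i, c' i))"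
    unfolding connection_sum_def using hom_mult[OF pair.tensor_class_hom] keys by simp
  then show ?thesis
    using keys X by (simp add: pair.tensor_class_mem)
qed

end

section \<open>Specialisation to the component of degree g\<close>

theorem proposition16p2:
  fixes scale :: "complex \<Rightarrow> 'w::ring \<Rightarrow> 'w" and unt :: 'w
    and B :: "'w set" and Bk :: "'g::group_add \<Rightarrow> 'w set"
    and \<Omega> \<Omega>A :: "nat \<Rightarrow> 'w set" and \<Omega>k :: "nat \<Rightarrow> 'g \<Rightarrow> 'w set" and d :: "'w \<Rightarrow> 'w"
    and g :: 'g and N :: nat and c c' :: "nat \<Rightarrow> 'w"
  assumes "graded_algebra scale unt B Bk"
    and "hopf_galois scale B Bk"
    and "graded_differential_calculus scale unt B \<Omega> d Bk \<Omega>k"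
    and "sub_calculus scale unt B \<Omega> d (Bk 0) \<Omega>A"
    and "\<And>k b \<xi> b'. b \<in> Bk k \<Longrightarrow> \<xi> \<in> \<Omega>A 1 \<Longrightarrow> b' \<in> Bk (- k) \<Longrightarrow> b * \<xi> * b' \<in> \<Omega>A 1"
    and "\<And>i. i < N \<Longrightarrow> c i \<in> Bk (- g)"
    and "\<And>i. i < N \<Longrightarrow> c' i \<in> Bk g"
    and "(\<Sum>i<N. c i * c' i) = unt"
  shows "let L = Bk g; T1 = forms_tensor \<Omega>A 1 L; T2 = forms_tensor \<Omega>A 2 L in
    (\<forall>D\<in>L \<rightarrow> carrier T1. \<forall>\<Gamma>\<in>L \<rightarrow> carrier T1.
      (\<forall>e\<in>L. D e = tensor_class T1 (\<Sum>i<N. frag_of (d (e * c i), c' i)) \<otimes>\<^bsub>T1\<^esub> \<Gamma> e) \<longrightarrow>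
      (left_covariant_derivative scale d \<Omega>A L D \<longleftrightarrow>
        (\<exists>\<zeta>\<in>\<Omega>A 1. \<forall>e\<in>L. \<Gamma> e = tensor_class T1 (\<Sum>i<N. frag_of (e * \<zeta> * c i, c' i))))) \<and>
    (\<forall>D. left_covariant_derivative scale d \<Omega>A L D \<longleftrightarrow>
      (\<exists>\<zeta>\<in>\<Omega>A 1. \<forall>e\<in>L. D e =
        tensor_class T1 ((\<Sum>i<N. frag_of (d (e * c i), c' i)) +
                         (\<Sum>i<N. frag_of (e * \<zeta> * c i, c' i))))) \<and>
    (\<forall>\<zeta>\<in>\<Omega>A 1. \<forall>D.
      (\<forall>e\<in>L. D e =
        tensor_class T1 ((\<Sum>i<N. frag_of (d (e * c i), c' i)) +
                         (\<Sum>i<N. frag_of (e * \<zeta> * c i, c' i)))) \<longrightarrow>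
      (\<forall>e\<in>L.
        curvature d \<Omega>A L D e =
          tensor_class T2
            ((\<Sum>j<N. \<Sum>i<N. frag_of (e * c j * d (c' j * \<zeta> * c i), c' i)) -
             (\<Sum>k<N. \<Sum>i<N. \<Sum>j<N. frag_of (e * c k * d (c' k * c i) * d (c' i * c j), c' j)) -
             (\<Sum>i<N. \<Sum>j<N. frag_of (e * \<zeta> * c i * (c' i * \<zeta> * c j), c' j))) \<and>
        curvature d \<Omega>A L D e =
          tensor_class T2
            ((\<Sum>j<N. \<Sum>i<N. frag_of (e * c j * d (c' j * \<zeta> * c i), c' i)) -
             (\<Sum>i<N. \<Sum>j<N. frag_of (d (e * c i) * d (c' i * c j), c' j)) -
             (\<Sum>i<N. \<Sum>j<N. frag_of (e * \<zeta> * c i * (c' i * \<zeta> * c j), c' j)))))"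
proof -
  interpret graded_algebra scale unt B Bk by fact
  interpret sub: sub_calculus scale unt B \<Omega> d "Bk 0" \<Omega>A by fact
  \<comment> \<open>The \<open>c i\<close> must be forms of degree 0 in the calculus of
    \<open>B\<close> for the Leibniz rule to apply to them.\<close>
  have Bk_subset: "Bk k \<subseteq> B" for k
    using component_subset[OF direct_sum] subspace_0[OF subspace_component] by blast
  interpret framed_calculus scale unt B \<Omega> d "Bk 0" \<Omega>A "Bk g" N c c'
  proof
    show "l * \<xi> * c i \<in> \<Omega>A 1" if "l \<in> Bk g" "\<xi> \<in> \<Omega>A 1" "i < N" for l \<xi> i
      using that assms(5,6) by blast
    \<comment> \<open>The assumption on one-forms at degree \<open>- g\<close>, where the right
      factor has degree \<open>- (- g) = g\<close>.\<close>
    show "c i * \<xi> * l \<in> \<Omega>A 1" if "i < N" "\<xi> \<in> \<Omega>A 1" "l \<in> Bk g" for i \<xi> l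
      using that assms(5)[of "c i" "- g" \<xi> l] assms(6) by simp
    show "a * l \<in> Bk g" if "a \<in> Bk 0" "l \<in> Bk g" for a l
      using mult_mem[OF that] by simp
    show "l * c i \<in> Bk 0" if "l \<in> Bk g" "i < N" for l i
      using mult_mem[OF that(1) assms(6)[OF that(2)]] by simp
    show "c i \<in> B" if "i < N" for i
      using assms(6)[OF that] Bk_subset by blast
  qed (use assms(7,8) subspace_component in auto)
  \<comment> \<open>For fixed \<zeta> and \<open>e\<close> the conditions on \<open>D\<close> and on
    \<open>\<Gamma>\<close> are equivalent, so the same \<zeta> serves both descriptions.\<close>
  have potential: "left_covariant_derivative scale d \<Omega>A (Bk g) D \<longleftrightarrow>
      (\<exists>\<zeta>\<in>\<Omega>A 1. \<forall>e\<in>Bk g. \<Gamma> e = tensor_class (T 1) (\<Sum>i<N. frag_of (e * \<zeta> * c i, c' i)))"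
    if "\<Gamma> \<in> Bk g \<rightarrow> carrier (T 1)"
      "\<forall>e\<in>Bk g. D e = tensor_class (T 1) (\<Sum>i<N. frag_of (d (e * c i), c' i)) \<otimes>\<^bsub>T 1\<^esub> \<Gamma> e" for D \<Gamma>
    using that unfolding left_covariant_derivative_iff_potential
    by (intro bex_cong ball_cong refl) (simp add: potential_iff funcset_mem)
  show ?thesis
    unfolding Let_def forms_tensor_def connection_sum_def[symmetric]
    by (intro conjI allI impI ballI potential left_covariant_derivative_iff_potential curvature_formulas) blast+
qed

end
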